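(* Let $\mu\ge 0$ and $$A=\begin{pmatrix}0&1&0\\0&0&0\\0&0&0\end{pmatrix},\qquad B=C=\begin{pmatrix}2&0&0\\0&1&0\\0&0&1\end{pmatrix},$$ and consider the unconstrained problem $$\min_{X\in\mathbb{R}^{3\times 3}}\ \|A-BXC\|_F^2+\mu\|X\|_F^2 .$$ With $P_B,P_C$ the orthogonal projectors onto the column space of $B$ and the row space of $C$, one has $(I-P_B)AP_C=0$ and $P_BA(I-P_C)=0$. However: (a) for every pair of SVDs $B=U_B\Sigma_BV_B^T$, $C=U_C\Sigma_CV_C^T$, the matrix $U_B^TAV_C$ is not diagonal; (b) the problem has a unique minimizer, namely $$X^*=\frac{1}{4+\mu}\begin{pmatrix}0&2&0\\0&0&0\\0&0&0\end{pmatrix};$$ (c) for every pair of SVDs $B=U_B\Sigma_BV_B^T$, $C=U_C\Sigma_CV_C^T$, there is no diagonal matrix $\Sigma\in\mathbb{R}^{3\times3}$ with $X^*=V_B\Sigma U_C^T$. In particular, the problem has no optimal solution of the form $V_B\Sigma U_C^T$ with $\Sigma$ diagonal.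
   Context: $\|\cdot\|_F$ is the Frobenius norm. Here an SVD $B=U_B\Sigma_BV_B^T$ (resp. $C=U_C\Sigma_CV_C^T$) means that $U_B,V_B$ (resp. $U_C,V_C$) are orthogonal $3\times 3$ matrices and $\Sigma_B$ (resp. $\Sigma_C$) is diagonal with the singular values on its diagonal arranged in non-increasing order, so $\Sigma_B=\Sigma_C=\mathrm{Diag}(2,1,1)$. *)

theory Defs
  imports "HOL-Analysis.Analysis"
begin

definition frobenius_norm :: "real^'n^'m \<Rightarrow> real" where
  "frobenius_norm M = sqrt (\<Sum>i\<in>UNIV. \<Sum>j\<in>UNIV. (M $ i $ j)\<^sup>2)"

lemma frobenius_norm_eq_norm: "frobenius_norm M = norm M"
  by (simp add: frobenius_norm_def norm_vec_def L2_set_def sum_nonneg)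

definition diagonal_matrix :: "real^'n^'n \<Rightarrow> bool" where
  "diagonal_matrix M \<longleftrightarrow> (\<forall>i j. i \<noteq> j \<longrightarrow> M $ i $ j = 0)"

(* The order of the diagonal entries is written out because 3 = 0 in the index type 3,
   so the order of that type is not the order in which the rows are numbered. *)
definition is_svd3 :: "real^3^3 \<Rightarrow> real^3^3 \<Rightarrow> real^3^3 \<Rightarrow> real^3^3 \<Rightarrow> bool" where
  "is_svd3 M U S V \<longleftrightarrow>
     orthogonal_matrix U \<and> orthogonal_matrix V \<and> diagonal_matrix S \<and>
     S $ 1 $ 1 \<ge> S $ 2 $ 2 \<and> S $ 2 $ 2 \<ge> S $ 3 $ 3 \<and> S $ 3 $ 3 \<ge> 0 \<and>
     M = U ** S ** transpose V"

definition orthogonal_projector :: "(real^'n) set \<Rightarrow> real^'n^'n" where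
  "orthogonal_projector W =
     (THE P. P ** P = P \<and> transpose P = P \<and> range ((*v) P) = W)"

definition objective ::
  "real^'n^'m \<Rightarrow> real^'p^'m \<Rightarrow> real^'n^'q \<Rightarrow> real \<Rightarrow> real^'q^'p \<Rightarrow> real" where
  "objective A B C \<mu> X =
     (frobenius_norm (A - B ** X ** C))\<^sup>2 + \<mu> * (frobenius_norm X)\<^sup>2"

definition is_minimizer ::
  "real^'n^'m \<Rightarrow> real^'p^'m \<Rightarrow> real^'n^'q \<Rightarrow> real \<Rightarrow> real^'q^'p \<Rightarrow> bool" where
  "is_minimizer A B C \<mu> X \<longleftrightarrow> is_arg_min (objective A B C \<mu>) (\<lambda>_. True) X"

end

theory Submission
  imports Defs
begin

text \<open>The counterexample works because \<open>B = C\<close> is diagonal and positive definite with the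
simple largest singular value \<open>2\<close>, while \<open>A = e\<^sub>1 e\<^sub>2\<^sup>T\<close> maps the second coordinate axis to the first.

In every SVD \<open>B = U S V\<^sup>T\<close> the factors \<open>U\<close> and \<open>V\<close> coincide and mix only coordinates with equal
diagonal entries of \<open>B\<close> (\<open>svd3_pos_diagonal\<close>). As \<open>2\<close> is simple, the first singular vector
must therefore be \<open>\<plusminus>e\<^sub>1\<close>, and the rest of the freedom is an orthogonal map of the plane spanned by
\<open>e\<^sub>2\<close> and \<open>e\<^sub>3\<close>. Changing coordinates by such matrices turns \<open>e\<^sub>1 e\<^sub>2\<^sup>T\<close> into
\<open>\<plusminus>e\<^sub>1 w\<^sup>T\<close> with a unit vector \<open>w\<close> orthogonal to \<open>e\<^sub>1\<close>, which has a nonzero entry off the diagonal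
(\<open>svd_conjugate_not_diagonal\<close>). This is (a); since the minimizer is a nonzero multiple of \<open>A\<close>
and left and right singular vectors agree, it is also (c).

For diagonal \<open>B\<close> and \<open>C\<close> the objective is a sum of one-variable quadratics, one for each entry
of \<open>X\<close>, and completing the squares gives the unique minimizer
(\<open>diagonal_objective_unique_minimizer\<close>). Finally, both projectors are the identity because \<open>B\<close> is
invertible.\<close>

section \<open>Projectors onto the whole space\<close>

text \<open>A surjective idempotent fixes every vector, so the description that defines the projector
is satisfied by the identity alone.\<close>
lemma orthogonal_projector_UNIV: "orthogonal_projector (UNIV :: (real^'n) set) = mat 1"
  unfolding orthogonal_projector_def
proof (rule the_equality)
  show "mat 1 ** mat 1 = (mat 1 :: real^'n^'n) \<and> transpose (mat 1) = (mat 1 :: real^'n^'n)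
      \<and> range ((*v) (mat 1 :: real^'n^'n)) = UNIV"
    by simp
next
  fix P :: "real^'n^'n"
  assume P: "P ** P = P \<and> transpose P = P \<and> range ((*v) P) = UNIV"
  have "P *v x = mat 1 *v x" for x
  proof -
    obtain y where "x = P *v y" using P by (metis surjD)
    then show ?thesis using P by (simp add: matrix_vector_mul_assoc)
  qed
  then show "P = mat 1" by (simp add: matrix_eq)
qed

section \<open>Products with diagonal matrices\<close>

lemma diagonal_mult_left:
  fixes D :: "real^'n^'n" and X :: "real^'m^'n"
  assumes "diagonal_matrix D"
  shows "(D ** X) $ i $ j = D $ i $ i * X $ i $ j"
proof -
  have "(D ** X) $ i $ j = (\<Sum>k\<in>UNIV. D $ i $ k * X $ k $ j)"
    by (simp add: matrix_matrix_mult_def)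
  also have "\<dots> = (\<Sum>k\<in>UNIV. if k = i then D $ i $ i * X $ i $ j else 0)"
    using assms by (intro sum.cong) (auto simp: diagonal_matrix_def)
  finally show ?thesis by simp
qed

lemma diagonal_mult_right:
  fixes D :: "real^'n^'n" and X :: "real^'n^'m"
  assumes "diagonal_matrix D"
  shows "(X ** D) $ i $ j = X $ i $ j * D $ j $ j"
proof -
  have "(X ** D) $ i $ j = (\<Sum>k\<in>UNIV. X $ i $ k * D $ k $ j)"
    by (simp add: matrix_matrix_mult_def)
  also have "\<dots> = (\<Sum>k\<in>UNIV. if k = j then X $ i $ j * D $ j $ j else 0)"
    using assms by (intro sum.cong) (auto simp: diagonal_matrix_def)
  finally show ?thesis by simp
qed

lemma transpose_diagonal:
  fixes D :: "real^'n^'n"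
  assumes "diagonal_matrix D"
  shows "transpose D = D"
  using assms by (simp add: vec_eq_iff transpose_def diagonal_matrix_def) metis

lemma orthogonal_matrix_row_sum:
  fixes U :: "real^'n^'n"
  assumes "orthogonal_matrix U"
  shows "(\<Sum>k\<in>UNIV. U $ i $ k * U $ j $ k) = (if i = j then 1 else 0)"
proof -
  have "(U ** transpose U) $ i $ j = mat 1 $ i $ j"
    using assms by (simp add: orthogonal_matrix_def)
  then show ?thesis by (simp add: matrix_matrix_mult_def transpose_def mat_def)
qed

lemma orthogonal_matrix_column_nonzero:
  fixes U :: "real^'n^'n"
  assumes "orthogonal_matrix U"
  shows "\<exists>i. U $ i $ j \<noteq> 0"
proof (rule ccontr)
  assume "\<nexists>i. U $ i $ j \<noteq> 0"
  then have "(\<Sum>k\<in>UNIV. transpose U $ j $ k * transpose U $ j $ k) = 0"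
    by (simp add: transpose_def)
  with orthogonal_matrix_row_sum[of "transpose U" j j] assms show False by simp
qed

lemma orthogonal_matrix_row_nonzero:
  fixes U :: "real^'n^'n"
  assumes "orthogonal_matrix U"
  shows "\<exists>j. U $ i $ j \<noteq> 0"
proof -
  have "orthogonal_matrix (transpose U)" using assms by simp
  from orthogonal_matrix_column_nonzero[OF this, of i] show ?thesis by (simp add: transpose_def)
qed

section \<open>Singular value decompositions of a positive diagonal matrix\<close>

text \<open>With \<open>b\<^sub>i\<close> and \<open>s\<^sub>j\<close> the diagonal entries, \<open>B V = U S\<close> and \<open>B\<^sup>T U = V S\<close> read
\<open>b\<^sub>i v\<^sub>i\<^sub>j = u\<^sub>i\<^sub>j s\<^sub>j\<close> and \<open>b\<^sub>i u\<^sub>i\<^sub>j = v\<^sub>i\<^sub>j s\<^sub>j\<close>. Subtracting them gives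
\<open>(b\<^sub>i + s\<^sub>j) (u\<^sub>i\<^sub>j - v\<^sub>i\<^sub>j) = 0\<close> with \<open>b\<^sub>i + s\<^sub>j > 0\<close>, hence \<open>U = V\<close>, and then either equation says
\<open>(b\<^sub>i - s\<^sub>j) u\<^sub>i\<^sub>j = 0\<close>.\<close>
lemma svd3_pos_diagonal:
  assumes svd: "is_svd3 B U S V" and B: "diagonal_matrix B" and pos: "\<And>i. B $ i $ i > 0"
  shows "V = U" and "U $ i $ j \<noteq> 0 \<Longrightarrow> S $ j $ j = B $ i $ i"
proof -
  have S: "diagonal_matrix S" and U: "orthogonal_matrix U" and V: "orthogonal_matrix V"
    and eq: "B = U ** S ** transpose V"
    using svd by (auto simp: is_svd3_def)
  have nonneg: "S $ j $ j \<ge> 0" for j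
    using svd exhaust_3[of j] by (auto simp: is_svd3_def)
  have "B ** V = U ** S ** (transpose V ** V)" by (simp add: eq matrix_mul_assoc)
  then have BV: "B ** V = U ** S" using V by (simp add: orthogonal_matrix_def)
  have "transpose B ** U = V ** transpose S ** (transpose U ** U)"
    by (simp add: eq matrix_transpose_mul matrix_mul_assoc)
  then have BU: "B ** U = V ** S"
    using U by (simp add: orthogonal_matrix_def transpose_diagonal B S)
  have 1: "B $ i $ i * V $ i $ j = U $ i $ j * S $ j $ j" for i j
    using arg_cong[OF BV, of "\<lambda>M. M $ i $ j"]
    by (simp add: diagonal_mult_left[OF B] diagonal_mult_right[OF S])
  have 2: "B $ i $ i * U $ i $ j = V $ i $ j * S $ j $ j" for i j
    using arg_cong[OF BU, of "\<lambda>M. M $ i $ j"]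
    by (simp add: diagonal_mult_left[OF B] diagonal_mult_right[OF S])
  have eq_entry: "V $ i $ j = U $ i $ j" for i j
  proof -
    have "(B $ i $ i + S $ j $ j) * (U $ i $ j - V $ i $ j) = 0"
      using 1[of i j] 2[of i j] by (simp add: algebra_simps)
    moreover have "B $ i $ i + S $ j $ j \<noteq> 0" using pos[of i] nonneg[of j] by linarith
    ultimately show ?thesis by simp
  qed
  then show "V = U" by (simp add: vec_eq_iff)
  show "S $ j $ j = B $ i $ i" if "U $ i $ j \<noteq> 0"
    using 1[of i j] that by (simp add: eq_entry)
qed

text \<open>Some singular value equals \<open>b\<^sub>1\<close>, because row 1 of \<open>U\<close> is not zero; being the strict
maximum, it is the first one. Only entry 1 of column 1 belongs to a diagonal entry of that size.\<close>
lemma svd3_strict_max_first_vector: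
  assumes svd: "is_svd3 B U S V" and B: "diagonal_matrix B" and pos: "\<And>i. B $ i $ i > 0"
    and max: "\<And>i. i \<noteq> 1 \<Longrightarrow> B $ i $ i < B $ 1 $ 1"
  shows "U $ 1 $ 1 \<noteq> 0" and "i \<noteq> 1 \<Longrightarrow> U $ i $ 1 = 0"
proof -
  note val = svd3_pos_diagonal(2)[OF svd B pos]
  have U: "orthogonal_matrix U" using svd by (simp add: is_svd3_def)
  have S1: "S $ j $ j \<le> S $ 1 $ 1" for j
    using svd exhaust_3[of j] by (auto simp: is_svd3_def)
  obtain k where "U $ 1 $ k \<noteq> 0"
    using orthogonal_matrix_row_nonzero[OF U] by blast
  then have "B $ 1 $ 1 \<le> S $ 1 $ 1" using val[of 1 k] S1[of k] by simp
  then show col: "U $ i $ 1 = 0" if "i \<noteq> 1" for i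
    using val[of i 1] max[OF that] by force
  obtain l where "U $ l $ 1 \<noteq> 0" using orthogonal_matrix_column_nonzero[OF U] by blast
  then show "U $ 1 $ 1 \<noteq> 0" using col by metis
qed

text \<open>Row 2 of \<open>U'\<close> vanishes at position 1, hence not at some \<open>j \<noteq> 1\<close>, and the entry \<open>(1, j)\<close> of
the product is \<open>u\<^sub>1\<^sub>1 a\<^sub>1\<^sub>2 u'\<^sub>2\<^sub>j \<noteq> 0\<close>.\<close>
lemma svd_conjugate_not_diagonal:
  fixes A B C :: "real^3^3"
  assumes B: "diagonal_matrix B" "\<And>i. B $ i $ i > 0" "\<And>i. i \<noteq> 1 \<Longrightarrow> B $ i $ i < B $ 1 $ 1"
    and C: "diagonal_matrix C" "\<And>i. C $ i $ i > 0" "\<And>i. i \<noteq> 1 \<Longrightarrow> C $ i $ i < C $ 1 $ 1"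
    and svdB: "is_svd3 B U S V" and svdC: "is_svd3 C U' S' V'"
    and A: "\<And>i j. A $ i $ j \<noteq> 0 \<longleftrightarrow> i = 1 \<and> j = 2"
  shows "\<not> diagonal_matrix (transpose U ** A ** U')"
proof
  assume diag: "diagonal_matrix (transpose U ** A ** U')"
  have "orthogonal_matrix U'" using svdC by (simp add: is_svd3_def)
  then obtain j where j: "U' $ 2 $ j \<noteq> 0"
    using orthogonal_matrix_row_nonzero by blast
  moreover have "U' $ 2 $ 1 = 0" by (rule svd3_strict_max_first_vector(2)[OF svdC C]) auto
  ultimately have "j \<noteq> 1" by metis
  have A0: "A $ i $ k = 0" if "i \<noteq> 1 \<or> k \<noteq> 2" for i k using A that by blast
  have "(transpose U ** A ** U') $ 1 $ j = U $ 1 $ 1 * A $ 1 $ 2 * U' $ 2 $ j"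
    by (simp add: matrix_matrix_mult_def transpose_def sum_3 A0)
  moreover have "U $ 1 $ 1 \<noteq> 0" by (rule svd3_strict_max_first_vector(1)[OF svdB B])
  moreover have "A $ 1 $ 2 \<noteq> 0" using A by blast
  ultimately show False using diag j \<open>j \<noteq> 1\<close> by (auto simp: diagonal_matrix_def)
qed

section \<open>The minimizer for diagonal coefficients\<close>

text \<open>The squared Frobenius norm separates over the entries of \<open>X\<close>, and with \<open>p = b\<^sub>i c\<^sub>j\<close>
and \<open>y = p a / (p\<^sup>2 + \<mu>)\<close> completing the square gives
\<open>(a - p x)\<^sup>2 + \<mu> x\<^sup>2 = (a - p y)\<^sup>2 + \<mu> y\<^sup>2 + (p\<^sup>2 + \<mu>) (x - y)\<^sup>2\<close>.
The coefficient \<open>p\<^sup>2 + \<mu>\<close> is positive, so every entry of the minimizer is determined.\<close>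
lemma diagonal_objective_unique_minimizer:
  fixes A :: "real^'n^'m" and B :: "real^'m^'m" and C :: "real^'n^'n"
  assumes B: "diagonal_matrix B" "\<And>i. B $ i $ i \<noteq> 0"
    and C: "diagonal_matrix C" "\<And>j. C $ j $ j \<noteq> 0"
    and mu: "\<mu> \<ge> 0"
    and Y: "\<And>i j. ((B $ i $ i * C $ j $ j)\<^sup>2 + \<mu>) * Y $ i $ j = B $ i $ i * C $ j $ j * A $ i $ j"
  shows "is_minimizer A B C \<mu> X \<longleftrightarrow> X = Y"
proof -
  define w where "w i j = (B $ i $ i * C $ j $ j)\<^sup>2 + \<mu>" for i j
  have w: "w i j > 0" for i j
    using B(2) C(2) mu by (simp add: w_def add_pos_nonneg)
  have norm_sq: "(frobenius_norm M)\<^sup>2 = (\<Sum>i\<in>UNIV. \<Sum>j\<in>UNIV. (M $ i $ j)\<^sup>2)" for M :: "real^'n^'m"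
    by (simp add: frobenius_norm_def sum_nonneg)
  have obj: "objective A B C \<mu> Z =
      (\<Sum>i\<in>UNIV. \<Sum>j\<in>UNIV. (A $ i $ j - B $ i $ i * Z $ i $ j * C $ j $ j)\<^sup>2 + \<mu> * (Z $ i $ j)\<^sup>2)" for Z
    by (simp add: objective_def norm_sq diagonal_mult_left[OF B(1)] diagonal_mult_right[OF C(1)]
        sum.distrib sum_distrib_left)
  have square: "(A $ i $ j - B $ i $ i * Z $ i $ j * C $ j $ j)\<^sup>2 + \<mu> * (Z $ i $ j)\<^sup>2
      = ((A $ i $ j - B $ i $ i * Y $ i $ j * C $ j $ j)\<^sup>2 + \<mu> * (Y $ i $ j)\<^sup>2)
        + w i j * (Z $ i $ j - Y $ i $ j)\<^sup>2" for Z i j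
    using Y[of i j] unfolding w_def by algebra
  have gap: "objective A B C \<mu> Z = objective A B C \<mu> Y
      + (\<Sum>i\<in>UNIV. \<Sum>j\<in>UNIV. w i j * (Z $ i $ j - Y $ i $ j)\<^sup>2)" for Z
    unfolding obj by (subst square) (simp add: sum.distrib)
  have nonneg: "w i j * (Z $ i $ j - Y $ i $ j)\<^sup>2 \<ge> 0" for Z i j
    using w[of i j] by simp
  have le: "objective A B C \<mu> Y \<le> objective A B C \<mu> Z" for Z
    unfolding gap[of Z] by (simp add: sum_nonneg nonneg)
  show ?thesis
  proof
    assume "X = Y"
    then show "is_minimizer A B C \<mu> X"
      using le by (simp add: is_minimizer_def is_arg_min_linorder)
  next
    assume "is_minimizer A B C \<mu> X"
    then have "objective A B C \<mu> X \<le> objective A B C \<mu> Y"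
      by (simp add: is_minimizer_def is_arg_min_linorder)
    then have "(\<Sum>i\<in>UNIV. \<Sum>j\<in>UNIV. w i j * (X $ i $ j - Y $ i $ j)\<^sup>2) = 0"
      unfolding gap[of X] by (intro antisym sum_nonneg nonneg) auto
    then have "w i j * (X $ i $ j - Y $ i $ j)\<^sup>2 = 0" for i j
      by (simp add: sum_nonneg_eq_0_iff sum_nonneg nonneg)
    then show "X = Y"
      using w by (simp add: vec_eq_iff less_imp_neq[symmetric])
  qed
qed

section \<open>The counterexample\<close>

theorem mainTheorem4:
  fixes \<mu> :: real and A B C Xopt P\<^sub>B P\<^sub>C :: "real^3^3"
  assumes "\<mu> \<ge> 0"
    and "A = vector [vector [0, 1, 0], vector [0, 0, 0], vector [0, 0, 0]]"
    and "B = vector [vector [2, 0, 0], vector [0, 1, 0], vector [0, 0, 1]]"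
    and "C = B"
    and "P\<^sub>B = orthogonal_projector (span (columns B))"
    and "P\<^sub>C = orthogonal_projector (span (rows C))"
    and "Xopt = (1 / (4 + \<mu>)) *\<^sub>R
           vector [vector [0, 2, 0], vector [0, 0, 0], vector [0, 0, 0]]"
  shows "(mat 1 - P\<^sub>B) ** A ** P\<^sub>C = 0 \<and> P\<^sub>B ** A ** (mat 1 - P\<^sub>C) = 0
    \<and> (\<forall>U\<^sub>B S\<^sub>B V\<^sub>B U\<^sub>C S\<^sub>C V\<^sub>C. is_svd3 B U\<^sub>B S\<^sub>B V\<^sub>B \<and> is_svd3 C U\<^sub>C S\<^sub>C V\<^sub>C
          \<longrightarrow> \<not> diagonal_matrix (transpose U\<^sub>B ** A ** V\<^sub>C))
    \<and> (\<forall>X. is_minimizer A B C \<mu> X \<longleftrightarrow> X = Xopt)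
    \<and> (\<forall>U\<^sub>B S\<^sub>B V\<^sub>B U\<^sub>C S\<^sub>C V\<^sub>C. is_svd3 B U\<^sub>B S\<^sub>B V\<^sub>B \<and> is_svd3 C U\<^sub>C S\<^sub>C V\<^sub>C
          \<longrightarrow> \<not> (\<exists>S. diagonal_matrix S \<and> Xopt = V\<^sub>B ** S ** transpose U\<^sub>C))
    \<and> (\<forall>U\<^sub>B S\<^sub>B V\<^sub>B U\<^sub>C S\<^sub>C V\<^sub>C. is_svd3 B U\<^sub>B S\<^sub>B V\<^sub>B \<and> is_svd3 C U\<^sub>C S\<^sub>C V\<^sub>C
          \<longrightarrow> \<not> (\<exists>S. diagonal_matrix S \<and>
                     is_minimizer A B C \<mu> (V\<^sub>B ** S ** transpose U\<^sub>C)))"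
proof -
  have B_entry: "B $ i $ j = (if i = j then if i = 1 then 2 else 1 else 0)" for i j
    using exhaust_3[of i] exhaust_3[of j] assms(3) by (auto simp: vector_3)
  have A_entry: "A $ i $ j = (if i = 1 \<and> j = 2 then 1 else 0)" for i j
    using exhaust_3[of i] exhaust_3[of j] assms(2) by (auto simp: vector_3)
  have X_entry: "Xopt $ i $ j = (if i = 1 \<and> j = 2 then 2 / (4 + \<mu>) else 0)" for i j
    using exhaust_3[of i] exhaust_3[of j] assms(7) by (auto simp: vector_3)
  have B: "diagonal_matrix B" "\<And>i. B $ i $ i > 0" "\<And>i. i \<noteq> 1 \<Longrightarrow> B $ i $ i < B $ 1 $ 1"
    by (auto simp: diagonal_matrix_def B_entry)
  have conj: "\<not> diagonal_matrix (transpose U ** M ** U')"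
    if "is_svd3 B U S V" "is_svd3 B U' S' V'" "\<And>i j. M $ i $ j \<noteq> 0 \<longleftrightarrow> i = 1 \<and> j = 2"
    for M U S V U' S' V'
    by (rule svd_conjugate_not_diagonal[OF B(1,2) _ B(1,2) _ that(1,2)]) (use B(3) that(3) in auto)

  have "invertible B" unfolding invertible_det_nz by (simp add: det_3 B_entry)
  then have "\<exists>B'. B ** B' = mat 1" "\<exists>B'. B' ** B = mat 1"
    by (auto simp: invertible_def)
  then have "span (columns B) = UNIV" "span (rows B) = UNIV"
    by (simp_all only: matrix_right_invertible_span_columns matrix_left_invertible_span_rows
        span_vec_eq)
  then have P: "P\<^sub>B = mat 1" "P\<^sub>C = mat 1"
    using assms(4-6) by (simp_all add: orthogonal_projector_UNIV)

  have a: "\<not> diagonal_matrix (transpose U\<^sub>B ** A ** V\<^sub>C)"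
    if "is_svd3 B U\<^sub>B S\<^sub>B V\<^sub>B" "is_svd3 C U\<^sub>C S\<^sub>C V\<^sub>C" for U\<^sub>B S\<^sub>B V\<^sub>B U\<^sub>C S\<^sub>C V\<^sub>C
  proof -
    have svdC: "is_svd3 B U\<^sub>C S\<^sub>C V\<^sub>C" using that(2) \<open>C = B\<close> by simp
    then have "V\<^sub>C = U\<^sub>C" using svd3_pos_diagonal(1) B(1,2) by blast
    then show ?thesis using conj[OF that(1) svdC, of A] by (simp add: A_entry)
  qed
  have b: "is_minimizer A B C \<mu> X \<longleftrightarrow> X = Xopt" for X
    unfolding \<open>C = B\<close>
    by (rule diagonal_objective_unique_minimizer)
      (use B(1) \<open>\<mu> \<ge> 0\<close> in \<open>auto simp: B_entry A_entry X_entry divide_eq_eq\<close>)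
  have c: "Xopt \<noteq> V\<^sub>B ** S ** transpose U\<^sub>C"
    if "is_svd3 B U\<^sub>B S\<^sub>B V\<^sub>B" "is_svd3 C U\<^sub>C S\<^sub>C V\<^sub>C" "diagonal_matrix S"
    for U\<^sub>B S\<^sub>B V\<^sub>B U\<^sub>C S\<^sub>C V\<^sub>C S
  proof
    assume X: "Xopt = V\<^sub>B ** S ** transpose U\<^sub>C"
    have svdC: "is_svd3 B U\<^sub>C S\<^sub>C V\<^sub>C" using that(2) \<open>C = B\<close> by simp
    have orth: "orthogonal_matrix V\<^sub>B" "orthogonal_matrix U\<^sub>C"
      using that(1,2) by (auto simp: is_svd3_def)
    have "transpose V\<^sub>B ** Xopt ** U\<^sub>C
        = (transpose V\<^sub>B ** V\<^sub>B) ** S ** (transpose U\<^sub>C ** U\<^sub>C)"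
      by (simp only: X matrix_mul_assoc)
    then have "transpose V\<^sub>B ** Xopt ** U\<^sub>C = S"
      using orth by (simp add: orthogonal_matrix_def)
    moreover have "V\<^sub>B = U\<^sub>B" using svd3_pos_diagonal(1) that(1) B(1,2) by blast
    moreover have "\<not> diagonal_matrix (transpose U\<^sub>B ** Xopt ** U\<^sub>C)"
      by (rule conj[OF that(1) svdC]) (use \<open>\<mu> \<ge> 0\<close> in \<open>auto simp: X_entry\<close>)
    ultimately show False using that(3) by simp
  qed
  have "(mat 1 - P\<^sub>B) ** A ** P\<^sub>C = 0" "P\<^sub>B ** A ** (mat 1 - P\<^sub>C) = 0"
    by (simp_all add: P)
  then show ?thesis unfolding b using a c
    by (intro conjI allI impI refl) (assumption | blast | metis)+
qed

end
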